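(* Let $\Psi=\Phi-\mathrm{Id}$ be the displacement function of a lift $\Phi$ of a transitive orientation preserving $C^1$-diffeomorphism $\varphi$ of the circle with irrational rotation number. Assume that $\Phi$ is conjugated with the translation by $\varrho(\varphi)$ by a $C^1$-diffeomorphism $\Gamma$ and that the set $C_\Psi\subset[0,1]$ of critical points of $\Psi$ has Lebesgue measure $0$. Then the density function $\Delta(y)$ of $\mu_\Psi$ with respect to the Lebesgue measure $\Lambda$ is equal to $$\Delta(y)=\begin{cases}0 & \text{if } y\notin\mathrm{supp}(\mu_\Psi),\\[4pt] \displaystyle\sum_{x\in\Psi^{-1}(y)\cap[0,1)}\Gamma'(x)\,\frac{1}{|\Phi'(x)-1|} & \text{if } y\in\mathrm{supp}(\mu_\Psi),\end{cases}$$ where the latter is well defined almost everywhere in $\mathrm{supp}(\mu_\Psi)$, namely in $\mathrm{supp}(\mu_\Psi)\setminus V_\Psi(C)$.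
   Context: $S^1$ is covered by $\mathbb{R}$ via $x\mapsto\exp(2\pi\mathrm{i}x)$. The lift is chosen with $\Phi(0)\in(0,1)$. Conjugated means: $\Gamma:\mathbb{R}\to\mathbb{R}$ is a lift of a circle diffeomorphism $\gamma$ (so $\Gamma(x+1)=\Gamma(x)+1$) with $\Gamma(\Phi(x))=\Gamma(x)+\varrho$, where $\varrho\in(0,1)$ is the rotation number $\varrho(\varphi)=\lim_n\Phi^n(x)/n \bmod 1$. $\mu$ is the unique $\varphi$-invariant Borel probability measure, regarded as a measure on $[0,1)$, and $\mu_\Psi(A)=\mu(\{x\in[0,1):\Psi(x)\in A\})$ is the displacement distribution. The critical points of $\Psi$ are the $x$ with $\Psi'(x)=\Phi'(x)-1=0$, and $V_\Psi(C)$ is the set of critical values of $\Psi$, i.e. the image under $\Psi$ of its set of critical points. *)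

theory Defs
  imports "HOL-Probability.Probability"
begin

text \<open>The circle is \<open>sphere (0::complex) 1\<close>. Maps of the circle are functions on \<open>complex\<close>,
  of which only the values on the unit circle matter.\<close>

definition circle_cov :: "real \<Rightarrow> complex" where
  "circle_cov x = exp (2 * of_real pi * \<i> * of_real x)"

text \<open>Since \<open>circle_cov\<close> is a local diffeomorphism onto the circle, a circle map is $C^1$ iff its
  composition with \<open>circle_cov\<close> is.\<close>

definition circle_C1_map :: "(complex \<Rightarrow> complex) \<Rightarrow> bool" where
  "circle_C1_map f \<longleftrightarrow>
     f ` sphere 0 1 \<subseteq> sphere 0 1 \<and> (f \<circ> circle_cov) C1_differentiable_on UNIV"

definition circle_C1_diffeo :: "(complex \<Rightarrow> complex) \<Rightarrow> bool" where
  "circle_C1_diffeo f \<longleftrightarrow>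
     bij_betw f (sphere 0 1) (sphere 0 1) \<and> circle_C1_map f
     \<and> circle_C1_map (the_inv_into (sphere 0 1) f)"

definition circle_lift :: "(complex \<Rightarrow> complex) \<Rightarrow> (real \<Rightarrow> real) \<Rightarrow> bool" where
  "circle_lift f F \<longleftrightarrow>
     continuous_on UNIV F \<and> (\<forall>x. f (circle_cov x) = circle_cov (F x))"

definition circle_orientation_preserving :: "(complex \<Rightarrow> complex) \<Rightarrow> bool" where
  "circle_orientation_preserving f \<longleftrightarrow> (\<exists>F. circle_lift f F \<and> strict_mono F)"

definition circle_transitive :: "(complex \<Rightarrow> complex) \<Rightarrow> bool" where
  "circle_transitive f \<longleftrightarrow>
     (\<exists>z \<in> sphere 0 1. sphere 0 1 \<subseteq> closure (range (\<lambda>n. (f ^^ n) z)))"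

text \<open>For a lift \<open>F\<close> of an orientation preserving circle homeomorphism the limit exists and does
  not depend on the base point (here 0); modulo 1 it does not depend on the lift either.\<close>

definition rotation_number :: "(real \<Rightarrow> real) \<Rightarrow> real" where
  "rotation_number F = frac (lim (\<lambda>n. (F ^^ n) 0 / real n))"

definition circle_invariant_prob :: "(complex \<Rightarrow> complex) \<Rightarrow> complex measure \<Rightarrow> bool" where
  "circle_invariant_prob f \<mu> \<longleftrightarrow>
     sets \<mu> = sets (restrict_space borel (sphere 0 1)) \<and> prob_space \<mu>
     \<and> f \<in> measurable \<mu> \<mu> \<and> distr \<mu> \<mu> f = \<mu>"

text \<open>A measure on the circle regarded as a measure on $[0,1)$, via the bijection that
  \<open>circle_cov\<close> induces between $[0,1)$ and the circle.\<close>

definition unit_interval_measure :: "complex measure \<Rightarrow> real measure" where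
  "unit_interval_measure \<mu> =
     distr \<mu> (restrict_space borel {0..<1}) (the_inv_into {0..<1} circle_cov)"

definition displacement :: "(real \<Rightarrow> real) \<Rightarrow> real \<Rightarrow> real" where
  "displacement F x = F x - x"

definition displacement_distribution :: "(real \<Rightarrow> real) \<Rightarrow> complex measure \<Rightarrow> real measure" where
  "displacement_distribution F \<mu> = distr (unit_interval_measure \<mu>) borel (displacement F)"

definition critical_points :: "(real \<Rightarrow> real) \<Rightarrow> real set" where
  "critical_points \<Psi> = {x \<in> {0..1}. deriv \<Psi> x = 0}"

definition measure_support :: "'a::topological_space measure \<Rightarrow> 'a set" where
  "measure_support M = {y. \<forall>U. open U \<and> y \<in> U \<longrightarrow> emeasure M U > 0}"

text \<open>\<open>f\<close> is a density of \<open>M\<close> with respect to Lebesgue measure. The completed measure is used, so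
  that the values of \<open>f\<close> on a null set are irrelevant, also for measurability.\<close>

definition is_lebesgue_density :: "real measure \<Rightarrow> (real \<Rightarrow> real) \<Rightarrow> bool" where
  "is_lebesgue_density M f \<longleftrightarrow>
     f \<in> borel_measurable lebesgue \<and> (\<forall>x. 0 \<le> f x)
     \<and> (\<forall>A \<in> sets borel. emeasure M A = (\<integral>\<^sup>+ y\<in>A. ennreal (f y) \<partial>lebesgue))"

text \<open>At critical values in the support the sum carries no meaning: infinite sums and division by
  zero evaluate to 0 there.\<close>

definition displacement_density ::
  "(real \<Rightarrow> real) \<Rightarrow> (real \<Rightarrow> real) \<Rightarrow> complex measure \<Rightarrow> real \<Rightarrow> real" where
  "displacement_density \<Phi> \<Gamma> \<mu> y =
     (if y \<notin> measure_support (displacement_distribution \<Phi> \<mu>) then 0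
      else (\<Sum>x \<in> displacement \<Phi> -` {y} \<inter> {0..<1}. deriv \<Gamma> x * (1 / \<bar>deriv \<Phi> x - 1\<bar>)))"

end

theory Submission
  imports Defs "HOL-Analysis.Kronecker_Approximation_Theorem"
begin

text \<open>Two facts carry the proof: the invariant measure on \<open>[0,1)\<close> is \<open>\<Gamma>'(x) dx\<close>, and the image of
  a measure with a density under a \<open>C\<^sup>1\<close> function is given by a sum over fibers.

  For the first fact, let \<open>N\<close> be the invariant measure on \<open>[0,1)\<close> and put
  \<open>H(x) = - \<integral> \<lfloor>t - x\<rfloor> dN(t)\<close>. This is the distribution function of \<open>N\<close>, extended to the line by
  \<open>H(x + 1) = H(x) + 1\<close>. A lift preserves order and commutes with integer translations, so
  \<open>\<lfloor>\<Phi>(t) - \<Phi>(x)\<rfloor> = \<lfloor>t - x\<rfloor>\<close>; together with the invariance of \<open>N\<close> this gives \<open>H \<circ> \<Phi> = H + c\<close> for a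
  constant \<open>c\<close>. In the coordinate \<open>u = \<Gamma>(x)\<close> the map \<open>\<Phi>\<close> is the translation by \<open>\<rho>\<close>, and \<open>H\<close> becomes
  a monotone function that commutes with the translation by 1 and turns the translation by \<open>\<rho>\<close> into
  the one by \<open>c\<close>. Boundedness of \<open>H(u) - u\<close> forces \<open>c = \<rho>\<close>, and density of
  \<open>\<int> + \<rho>\<int>\<close> in the line leaves only \<open>u + const\<close>
  (\<open>monotone_equivariant_translation\<close>). Hence \<open>N [0,x) = \<Gamma>(x) - \<Gamma>(0)\<close>
  (\<open>invariant_measure_lessThan\<close>), and the fundamental theorem of calculus gives the density \<open>\<Gamma>'\<close>.

  The second fact is the one-dimensional area formula (\<open>area_formula_real\<close>). Off its critical points
  \<open>\<Psi>\<close> is locally injective, so countably many disjoint Borel sets, on each of which \<open>\<Psi>\<close> is injective,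
  exhaust the noncritical points. The change of variables formula holds on each of them, and adding
  the results up produces the sum of \<open>\<Gamma>'(x) / |\<Psi>'(x)|\<close> over the noncritical points of a fiber.
  The critical points form a null set, so they do not contribute to the image measure.

  It remains to compare this density with the one in the theorem. On the support they agree off the
  image of the critical points, which is null because \<open>\<Psi>\<close> is \<open>C\<^sup>1\<close>; on the complement of the support
  both vanish almost everywhere. The fiber over a noncritical value is finite, since an accumulation
  point of it would be critical (\<open>finite_regular_fiber\<close>).\<close>

section \<open>Circle maps and their lifts\<close>

lemma circle_cov_eq_iff: "circle_cov x = circle_cov y \<longleftrightarrow> x - y \<in> \<int>"
proof
  assume "circle_cov x = circle_cov y"
  then obtain n :: int where n: "2 * of_real pi * \<i> * of_real x
      = 2 * of_real pi * \<i> * of_real y + (of_int (2 * n) * pi) * \<i>"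
    unfolding circle_cov_def exp_eq by blast
  have "pi * x = pi * y + of_int n * pi"
    using arg_cong[OF n, of Im] by simp
  then have "pi * (x - y) = pi * of_int n" by (simp add: algebra_simps)
  then show "x - y \<in> \<int>" by simp
next
  assume "x - y \<in> \<int>"
  then obtain n :: int where n: "x = y + of_int n" by (metis Ints_cases add.commute diff_add_cancel)
  show "circle_cov x = circle_cov y"
    unfolding circle_cov_def exp_eq by (rule exI[of _ n]) (simp add: n algebra_simps)
qed

lemma circle_cov_frac [simp]: "circle_cov (frac x) = circle_cov x"
  by (simp add: circle_cov_eq_iff frac_def)

lemma norm_circle_cov [simp]: "norm (circle_cov x) = 1"
  by (simp add: circle_cov_def)

lemma continuous_on_circle_cov: "continuous_on A circle_cov"
  unfolding circle_cov_def by (intro continuous_intros)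

lemma inj_on_circle_cov: "inj_on circle_cov {0..<1}"
proof (rule inj_onI)
  fix x y :: real assume xy: "x \<in> {0..<1}" "y \<in> {0..<1}" "circle_cov x = circle_cov y"
  then have "x - y \<in> \<int>" "\<bar>x - y\<bar> < 1" by (auto simp: circle_cov_eq_iff)
  then have "x - y = 0" by (rule Ints_nonzero_abs_less1)
  then show "x = y" by simp
qed

lemma circle_cov_image: "circle_cov ` {0..<1} = sphere 0 1"
proof
  show "sphere 0 1 \<subseteq> circle_cov ` {0..<1}"
  proof
    fix z :: complex assume "z \<in> sphere 0 1"
    then have "exp (\<i> * of_real (Arg2pi z)) = z" using complex_norm_eq_1_exp by simp
    then have "circle_cov (Arg2pi z / (2 * pi)) = z" by (simp add: circle_cov_def mult.commute)
    moreover have "Arg2pi z / (2 * pi) \<in> {0..<1}"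
      using Arg2pi_ge_0[of z] Arg2pi_lt_2pi[of z] by simp
    ultimately show "z \<in> circle_cov ` {0..<1}" by (rule image_eqI[OF sym])
  qed
qed auto

lemma the_inv_into_circle_cov: "the_inv_into {0..<1} circle_cov (circle_cov x) = frac x"
  by (rule the_inv_into_f_eq[OF inj_on_circle_cov]) (auto simp: frac_lt_1)

lemma circle_cov_the_inv_into:
  "z \<in> sphere 0 1 \<Longrightarrow> circle_cov (the_inv_into {0..<1} circle_cov z) = z"
  by (rule f_the_inv_into_f[OF inj_on_circle_cov]) (simp add: circle_cov_image)

lemma the_inv_into_circle_cov_in:
  "z \<in> sphere 0 1 \<Longrightarrow> the_inv_into {0..<1} circle_cov z \<in> {0..<1}"
  by (rule the_inv_into_into[OF inj_on_circle_cov]) (simp_all add: circle_cov_image)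

text \<open>The preimage of \<open>{..a}\<close> is the image of the compact interval \<open>[0,a]\<close> when \<open>a < 1\<close>, hence
  closed; this avoids the discontinuity of the argument function at 1.\<close>

lemma measurable_the_inv_into_circle_cov:
  "the_inv_into {0..<1} circle_cov \<in> borel_measurable (restrict_space borel (sphere 0 1))"
proof (rule borel_measurableI_le)
  let ?g = "the_inv_into {0..<1} circle_cov"
  fix a :: real
  have "{z \<in> sphere 0 1. ?g z \<le> a} = circle_cov ` ({0..<1} \<inter> {..a})"
  proof safe
    fix z :: complex assume "z \<in> sphere 0 1" "?g z \<le> a"
    then show "z \<in> circle_cov ` ({0..<1} \<inter> {..a})"
      using circle_cov_the_inv_into the_inv_into_circle_cov_in
      by (metis IntI atMost_iff imageI)
  next
    fix t :: real assume "t \<in> {0..<1}" "t \<le> a"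
    then show "?g (circle_cov t) \<le> a"
      by (simp add: the_inv_into_f_f[OF inj_on_circle_cov])
  qed auto
  also have "\<dots> \<in> sets borel"
  proof (cases "a < 1")
    case True
    then have "{0..<1} \<inter> {..a} = {0..a}" by auto
    then show ?thesis
      by (metis borel_closed compact_Icc compact_continuous_image compact_imp_closed
          continuous_on_circle_cov)
  next
    case False
    then have "{0..<1} \<inter> {..a} = {0..<1}" by auto
    then show ?thesis by (simp add: circle_cov_image)
  qed
  finally have "{z \<in> sphere 0 1. ?g z \<le> a} \<in> sets borel" .
  then show "{z \<in> space (restrict_space borel (sphere 0 1)). ?g z \<le> a}
      \<in> sets (restrict_space borel (sphere 0 1))"
    by (auto simp: space_restrict_space sets_restrict_space_iff)
qed

text \<open>Near a point, a lift is recovered from the circle-valued map by the principal logarithm of a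
  quotient close to 1. Differentiating this expression at the base point gives a formula for the
  derivative in which the logarithm no longer occurs, so that its continuity is visible globally.\<close>

lemma circle_lift_C1:
  assumes f: "circle_C1_map f" and F: "circle_lift f F"
  shows "\<exists>F'. (\<forall>x. (F has_real_derivative F' x) (at x)) \<and> continuous_on UNIV F'"
proof -
  define g where "g = (\<lambda>x. circle_cov (F x))"
  have "f \<circ> circle_cov = g"
    using F by (auto simp: circle_lift_def g_def)
  then obtain D where D: "\<And>x. (g has_vector_derivative D x) (at x)" and contD: "continuous_on UNIV D"
    using f by (auto simp: circle_C1_map_def C1_differentiable_on_def)
  have contF: "continuous_on UNIV F" using F by (simp add: circle_lift_def)
  have contg: "continuous_on UNIV g"
    unfolding g_def by (rule continuous_on_compose2[OF continuous_on_circle_cov contF]) auto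
  have g0: "g x \<noteq> 0" for x by (simp add: g_def circle_cov_def)
  define F' where "F' = (\<lambda>x. Im (D x / g x) / (2 * pi))"
  have "(F has_real_derivative F' x0) (at x0)" for x0
  proof -
    have quot: "((\<lambda>x. g x / g x0) has_vector_derivative (D x0 / g x0)) (at x0)"
      using has_vector_derivative_mult_left[OF D, of "1 / g x0"] by simp
    have "(Ln has_field_derivative 1) (at (g x0 / g x0))"
      using has_field_derivative_Ln[of 1] g0 by (auto simp: complex_nonpos_Reals_iff)
    from field_vector_diff_chain_at[OF quot this]
    have "((\<lambda>x. Ln (g x / g x0)) has_vector_derivative (D x0 / g x0)) (at x0)"
      by (simp add: o_def)
    from bounded_linear.has_vector_derivative[OF bounded_linear_Im this]
    have "((\<lambda>x. Im (Ln (g x / g x0))) has_real_derivative Im (D x0 / g x0)) (at x0)"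
      by (simp only: has_real_derivative_iff_has_vector_derivative)
    from DERIV_add[OF DERIV_const[of "F x0"] DERIV_cdivide[OF this, of "2 * pi"]]
    have d: "((\<lambda>x. F x0 + Im (Ln (g x / g x0)) / (2 * pi)) has_real_derivative F' x0) (at x0)"
      by (simp only: F'_def add_0)
    have "isCont F x0" using contF by (simp add: continuous_on_eq_continuous_at)
    then have "\<forall>\<^sub>F x in nhds x0. dist (F x) (F x0) < 1 / 2"
      unfolding isCont_def tendsto_iff eventually_nhds_conv_at by (auto simp del: less_divide_eq_numeral1)
    then have "\<forall>\<^sub>F x in nhds x0. F x = F x0 + Im (Ln (g x / g x0)) / (2 * pi)"
    proof eventually_elim
      case (elim x)
      have "g x / g x0 = exp (\<i> * of_real (2 * pi * (F x - F x0)))"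
        by (simp add: g_def circle_cov_def exp_diff[symmetric] algebra_simps)
      moreover have "\<bar>2 * pi * (F x - F x0)\<bar> < pi"
        using elim by (simp add: dist_real_def abs_mult)
      ultimately have "Ln (g x / g x0) = \<i> * of_real (2 * pi * (F x - F x0))"
        by (simp add: abs_less_iff)
      then show ?case by simp
    qed
    from DERIV_cong_ev[OF refl this refl] d show ?thesis by simp
  qed
  moreover have "continuous_on UNIV F'"
    unfolding F'_def using g0 by (intro continuous_intros contD contg) auto
  ultimately show ?thesis by blast
qed

lemma degree_one_add_int:
  fixes F :: "real \<Rightarrow> real"
  assumes "\<And>x. F (x + 1) = F x + 1"
  shows "F (x + of_int n) = F x + of_int n"
proof -
  have nat: "F (x + real k) = F x + real k" for x k
    by (induction k) (use assms in \<open>simp_all add: add.assoc[symmetric] add.commute[of 1]\<close>)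
  show ?thesis
  proof (cases "n \<ge> 0")
    case True then show ?thesis using nat[of x "nat n"] by simp
  next
    case False then show ?thesis using nat[of "x + of_int n" "nat (- n)"] by simp
  qed
qed

text \<open>An injective circle map has an injective lift: two points with the same value differ by an
  integer, which periodicity forces to be 0. A continuous injective function is strictly monotone,
  and \<open>F 1 > F 0\<close> excludes the decreasing case.\<close>

lemma circle_lift_strict_mono:
  assumes inj: "inj_on f (sphere 0 1)" and F: "circle_lift f F" and per: "\<And>x. F (x + 1) = F x + 1"
  shows "strict_mono F"
proof -
  have "inj F"
  proof (rule injI)
    fix x y assume eq: "F x = F y"
    then have "f (circle_cov x) = f (circle_cov y)" using F by (simp add: circle_lift_def)
    then have "circle_cov x = circle_cov y" by (rule inj_onD[OF inj]) auto
    then obtain n where "x - y = of_int n" by (auto simp: circle_cov_eq_iff elim: Ints_cases)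
    then have n: "x = y + of_int n" by simp
    then have "F x = F y + of_int n" using degree_one_add_int[where F = F, OF per] by simp
    then show "x = y" using eq n by simp
  qed
  then have "strict_mono_on UNIV F \<or> strict_antimono_on UNIV F"
    using F by (subst injective_eq_monotone_map[symmetric]) (auto simp: circle_lift_def is_interval_univ)
  moreover have "\<not> strict_antimono_on UNIV F"
  proof
    assume "strict_antimono_on UNIV F"
    then have "F (0 + 1) < F 0" by (simp add: monotone_on_def)
    then show False using per[of 0] by simp
  qed
  ultimately show ?thesis by blast
qed

lemma degree_one_surj:
  fixes F :: "real \<Rightarrow> real"
  assumes "continuous_on UNIV F" and per: "\<And>x. F (x + 1) = F x + 1"
  shows "surj F"
proof -
  have "\<exists>x. F x = y" for y
  proof -
    let ?n = "\<lfloor>y - F 0\<rfloor>"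
    have "F (0 + of_int ?n) \<le> y" "y \<le> F (0 + of_int (?n + 1))"
      unfolding degree_one_add_int[where F = F, OF per] by linarith+
    then show ?thesis
      using IVT'[of F "0 + of_int ?n" y "0 + of_int (?n + 1)"] assms(1)
      by (auto intro: continuous_on_subset)
  qed
  then show ?thesis unfolding surj_def by metis
qed

section \<open>Invariant measures of maps conjugate to an irrational rotation\<close>

text \<open>A monotone semiconjugacy from an irrational rotation to a rotation is a translation. The difference
  \<open>K(x) - x\<close> is 1-periodic, hence bounded; comparing \<open>K(n\<rho>) = K(0) + nc\<close> with \<open>n\<rho>\<close> for large \<open>n\<close> gives
  \<open>c = \<rho>\<close>. Thus \<open>K(s) = K(0) + s\<close> on the dense set of all \<open>k\<rho> - h\<close> with integers \<open>h\<close> and \<open>k > 0\<close>,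
  and monotonicity extends this to every point.\<close>

lemma monotone_equivariant_translation:
  fixes K :: "real \<Rightarrow> real"
  assumes mono: "mono K" and per: "\<And>x. K (x + 1) = K x + 1"
    and equiv: "\<And>x. K (x + \<rho>) = K x + c" and irr: "\<rho> \<notin> \<rat>"
  shows "K x = K 0 + x"
proof -
  have iter: "K (x + real n * \<rho>) = K x + real n * c" for x n
  proof (induction n)
    case (Suc n)
    have "K (x + real (Suc n) * \<rho>) = K ((x + real n * \<rho>) + \<rho>)" by (simp add: algebra_simps)
    then show ?case by (simp only: equiv Suc.IH) (simp add: algebra_simps)
  qed simp
  have bound: "\<bar>K x - x - K 0\<bar> \<le> 1" for x
  proof -
    have "K x = K (frac x + of_int \<lfloor>x\<rfloor>)" by (simp add: frac_def)
    then have "K x - x = K (frac x) - frac x"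
      by (simp add: degree_one_add_int[where F = K, OF per]) (simp add: frac_def)
    moreover have "K 0 \<le> K (frac x)" "K (frac x) \<le> K (0 + 1)"
      using frac_lt_1[of x] by (auto intro!: monoD[OF mono])
    ultimately show ?thesis using per[of 0] frac_lt_1[of x] frac_ge_0[of x] by linarith
  qed
  have "c = \<rho>"
  proof (rule ccontr)
    assume "c \<noteq> \<rho>"
    then obtain n :: nat where n: "1 < real n * \<bar>c - \<rho>\<bar>"
      using reals_Archimedean3[of "\<bar>c - \<rho>\<bar>"] by auto
    have "real n * (c - \<rho>) = K (real n * \<rho>) - real n * \<rho> - K 0"
      using iter[of 0 n] by (simp add: algebra_simps)
    then have "real n * \<bar>c - \<rho>\<bar> \<le> 1"
      using bound[of "real n * \<rho>"] by (simp add: abs_mult[symmetric])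
    then show False using n by simp
  qed
  have orbit: "\<exists>s. \<bar>s - x\<bar> < e \<and> K s = K 0 + s" if "e > 0" for x e :: real
  proof -
    obtain h k :: int where hk: "k > 0" "\<bar>of_int k * \<rho> - of_int h - x\<bar> < e"
      using sequence_of_fractional_parts_is_dense[OF irr \<open>e > 0\<close>] by blast
    have "K (of_int k * \<rho> + of_int (- h)) = K (0 + real (nat k) * \<rho>) + of_int (- h)"
      using hk(1) by (subst degree_one_add_int[where F = K, OF per]) simp
    then have "K (of_int k * \<rho> - of_int h) = K 0 + (of_int k * \<rho> - of_int h)"
      unfolding iter using hk(1) \<open>c = \<rho>\<close> by simp
    then show ?thesis using hk(2) by blast
  qed
  show ?thesis
  proof (rule antisym)
    show "K x \<le> K 0 + x"
    proof (rule field_le_epsilon)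
      fix e :: real assume "e > 0"
      then obtain s where s: "\<bar>s - (x + e / 2)\<bar> < e / 2" "K s = K 0 + s"
        using orbit[of "e / 2"] by (metis half_gt_zero)
      then have "K x \<le> K s" by (intro monoD[OF mono]) arith
      then show "K x \<le> K 0 + x + e" using s by arith
    qed
    show "K 0 + x \<le> K x"
    proof (rule field_le_epsilon)
      fix e :: real assume "e > 0"
      then obtain s where s: "\<bar>s - (x - e / 2)\<bar> < e / 2" "K s = K 0 + s"
        using orbit[of "e / 2"] by (metis half_gt_zero)
      then have "K s \<le> K x" by (intro monoD[OF mono]) arith
      then show "K 0 + x \<le> K x + e" using s by arith
    qed
  qed
qed

text \<open>The floor of \<open>t - x\<close> is the last \<open>n\<close> with \<open>x + n \<le> t\<close>, and an order-preserving map that commutes with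
  integer translations preserves this inequality.\<close>

lemma floor_diff_lift:
  fixes F :: "real \<Rightarrow> real"
  assumes F: "strict_mono F" and per: "\<And>x. F (x + 1) = F x + 1"
  shows "\<lfloor>F t - F x\<rfloor> = \<lfloor>t - x\<rfloor>"
proof (rule floor_unique)
  let ?n = "\<lfloor>t - x\<rfloor>"
  have "x + of_int ?n \<le> t" "t < x + of_int (?n + 1)" by linarith+
  then have "F (x + of_int ?n) \<le> F t" "F t < F (x + of_int (?n + 1))"
    using F by (simp_all only: strict_mono_less_eq strict_mono_less)
  then show "of_int ?n \<le> F t - F x" "F t - F x < of_int ?n + 1"
    using degree_one_add_int[where F = F, OF per, of x ?n]
      degree_one_add_int[where F = F, OF per, of x "?n + 1"] by simp_all
qed

text \<open>The function \<open>H\<close> in the proof is the distribution function of \<open>N\<close>, extended to the line. Writing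
  it as an integral of a floor function lets invariance be applied without splitting \<open>[0,1)\<close> at the
  point that \<open>\<Phi>\<close> moves across an integer.\<close>

lemma invariant_measure_lessThan:
  fixes N :: "real measure" and \<Phi> \<Gamma> :: "real \<Rightarrow> real"
  assumes "prob_space N" and sets: "sets N = sets borel" and AE_I: "AE t in N. t \<in> {0..<1}"
    and inv: "distr N borel (\<lambda>t. frac (\<Phi> t)) = N"
    and \<Phi>: "strict_mono \<Phi>" "\<And>x. \<Phi> (x + 1) = \<Phi> x + 1"
    and \<Gamma>: "strict_mono \<Gamma>" "surj \<Gamma>" "\<And>x. \<Gamma> (x + 1) = \<Gamma> x + 1"
    and conj: "\<And>x. \<Gamma> (\<Phi> x) = \<Gamma> x + \<rho>" and irr: "\<rho> \<notin> \<rat>"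
    and x: "x \<in> {0..1}"
  shows "measure N {..<x} = \<Gamma> x - \<Gamma> 0"
proof -
  interpret prob_space N by fact
  have meas [measurable_cong]: "sets N = sets borel" by (fact sets)
  have [measurable]: "\<Phi> \<in> borel_measurable borel"
    using \<Phi>(1) by (intro borel_measurable_mono strict_mono_mono)
  have int_floor: "integrable N (\<lambda>t. of_int \<lfloor>t - x\<rfloor> :: real)" for x
  proof (rule integrable_const_bound)
    show "AE t in N. norm (of_int \<lfloor>t - x\<rfloor> :: real) \<le> \<bar>x\<bar> + 2"
      using AE_I by eventually_elim (auto, linarith)
  qed measurable
  have int_floor_\<Phi>: "integrable N (\<lambda>t. of_int \<lfloor>\<Phi> t\<rfloor> :: real)"
  proof (rule integrable_const_bound)
    show "AE t in N. norm (of_int \<lfloor>\<Phi> t\<rfloor> :: real) \<le> \<bar>\<Phi> 0\<bar> + 2"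
      using AE_I
    proof eventually_elim
      case (elim t)
      then have "\<Phi> 0 \<le> \<Phi> t" "\<Phi> t < \<Phi> (0 + 1)"
        using \<Phi>(1) by (simp_all add: strict_mono_less_eq strict_mono_less)
      then show ?case using \<Phi>(2)[of 0] by simp linarith
    qed
  qed measurable
  define H :: "real \<Rightarrow> real" where "H = (\<lambda>x. - (\<integral>t. of_int \<lfloor>t - x\<rfloor> \<partial>N))"
  have H_mono: "mono H"
    unfolding H_def
    by (intro monoI le_imp_neg_le integral_mono int_floor) (simp add: floor_mono)
  have H_per: "H (x + 1) = H x + 1" for x
  proof -
    have "(\<integral>t. real_of_int \<lfloor>t - (x + 1)\<rfloor> \<partial>N) = (\<integral>t. of_int \<lfloor>t - x\<rfloor> - 1 \<partial>N)"
    proof (intro Bochner_Integration.integral_cong refl)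
      fix t
      have "t - (x + 1) = t - x - 1" by simp
      then show "of_int \<lfloor>t - (x + 1)\<rfloor> = (of_int \<lfloor>t - x\<rfloor> - 1 :: real)"
        by (simp only: floor_diff_one of_int_diff of_int_1)
    qed
    then show ?thesis using int_floor[of x] by (simp add: H_def prob_space)
  qed
  define c where "c = (\<integral>t. real_of_int \<lfloor>\<Phi> t\<rfloor> \<partial>N)"
  have H_\<Phi>: "H (\<Phi> x) = H x + c" for x
  proof -
    have "(\<integral>t. real_of_int \<lfloor>t - \<Phi> x\<rfloor> \<partial>N)
        = (\<integral>t. of_int \<lfloor>t - \<Phi> x\<rfloor> \<partial>distr N borel (\<lambda>t. frac (\<Phi> t)))"
      by (simp only: inv)
    also have "\<dots> = (\<integral>t. of_int \<lfloor>frac (\<Phi> t) - \<Phi> x\<rfloor> \<partial>N)"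
      unfolding frac_def by (rule integral_distr) measurable
    also have "\<dots> = (\<integral>t. of_int \<lfloor>t - x\<rfloor> - of_int \<lfloor>\<Phi> t\<rfloor> \<partial>N)"
    proof (intro Bochner_Integration.integral_cong refl)
      fix t
      \<comment> \<open>Reduction modulo 1 costs a term that does not depend on \<open>x\<close>; its integral is \<open>c\<close>.\<close>
      have "frac (\<Phi> t) - \<Phi> x = (\<Phi> t - \<Phi> x) - of_int \<lfloor>\<Phi> t\<rfloor>" by (simp add: frac_def)
      then have "\<lfloor>frac (\<Phi> t) - \<Phi> x\<rfloor> = \<lfloor>t - x\<rfloor> - \<lfloor>\<Phi> t\<rfloor>"
        by (simp only: floor_diff_of_int floor_diff_lift[OF \<Phi>])
      then show "of_int \<lfloor>frac (\<Phi> t) - \<Phi> x\<rfloor> = of_int \<lfloor>t - x\<rfloor> - (of_int \<lfloor>\<Phi> t\<rfloor> :: real)" by simp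
    qed
    finally show ?thesis using int_floor int_floor_\<Phi> by (simp add: H_def c_def)
  qed
  \<comment> \<open>In the coordinate \<open>\<Gamma>\<close> the lift \<open>\<Phi>\<close> becomes the translation by \<open>\<rho>\<close>.\<close>
  define G where "G = inv \<Gamma>"
  have G: "\<Gamma> (G u) = u" "G (\<Gamma> x) = x" for u x
    using \<Gamma> by (simp_all add: G_def surj_f_inv_f strict_mono_imp_inj_on)
  have G_mono: "mono G"
    by (rule monoI) (metis G(1) \<Gamma>(1) strict_mono_less_eq)
  have "H (G u) = H (G 0) + u" for u
  proof (rule monotone_equivariant_translation[OF _ _ _ irr, where c = c])
    show "mono (\<lambda>u. H (G u))" using H_mono G_mono by (simp add: mono_def)
    show "H (G (u + 1)) = H (G u) + 1" for u
      by (metis G H_per \<Gamma>(3))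
    show "H (G (u + \<rho>)) = H (G u) + c" for u
      by (metis G H_\<Phi> conj)
  qed
  then have H: "H x = H (G 0) + \<Gamma> x" for x by (metis G(2))
  have H_measure: "H x = measure N {..<x}" if "x \<in> {0..1}" for x
  proof -
    have "- H x = (\<integral>t. - indicator {..<x} t \<partial>N)"
      unfolding H_def minus_minus
    proof (rule integral_cong_AE)
      show "AE t in N. real_of_int \<lfloor>t - x\<rfloor> = - indicator {..<x} t"
        using AE_I
      proof eventually_elim
        case (elim t)
        have "\<lfloor>t - x\<rfloor> = (if t < x then - 1 else 0)"
          using elim that by (auto simp: floor_eq_iff)
        then show ?case by simp
      qed
    qed measurable
    then show ?thesis by simp
  qed
  have "{..<0} \<in> null_sets N"
    using AE_I by (subst AE_iff_null_sets) (auto simp: sets)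
  then have "H 0 = 0" using H_measure[of 0] by (simp add: null_setsD1 measure_def)
  then show ?thesis using H_measure[OF x] H[of x] H[of 0] by simp
qed

text \<open>Both sides give the half-line below \<open>x\<close> the mass \<open>\<Gamma>(x) - \<Gamma>(0)\<close>, where \<open>x\<close> is first clipped to
  \<open>[0,1]\<close>: on the left this is the preceding lemma, on the right the fundamental theorem of calculus.\<close>

lemma invariant_measure_eq_density:
  fixes N :: "real measure" and \<Phi> \<Gamma> \<Gamma>' :: "real \<Rightarrow> real"
  assumes "prob_space N" and sets: "sets N = sets borel" and AE_I: "AE t in N. t \<in> {0..<1}"
    and inv: "distr N borel (\<lambda>t. frac (\<Phi> t)) = N"
    and \<Phi>: "strict_mono \<Phi>" "\<And>x. \<Phi> (x + 1) = \<Phi> x + 1"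
    and \<Gamma>: "strict_mono \<Gamma>" "surj \<Gamma>" "\<And>x. \<Gamma> (x + 1) = \<Gamma> x + 1"
    and conj: "\<And>x. \<Gamma> (\<Phi> x) = \<Gamma> x + \<rho>" and irr: "\<rho> \<notin> \<rat>"
    and \<Gamma>': "\<And>x. (\<Gamma> has_real_derivative \<Gamma>' x) (at x)" "continuous_on UNIV \<Gamma>'" "\<And>x. 0 \<le> \<Gamma>' x"
  shows "N = density lborel (\<lambda>x. ennreal (\<Gamma>' x) * indicator {0..<1} x)" (is "N = ?D")
proof -
  interpret prob_space N by fact
  have [measurable]: "\<Gamma>' \<in> borel_measurable borel"
    using \<Gamma>'(2) by (rule borel_measurable_continuous_onI)
  have N: "emeasure N {..<x} = ennreal (\<Gamma> (max 0 (min 1 x)) - \<Gamma> 0)" for x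
  proof -
    have "emeasure N {..<x} = emeasure N {..<max 0 (min 1 x)}"
      using AE_I by (intro emeasure_eq_AE) (auto simp: sets)
    then show ?thesis
      using invariant_measure_lessThan[OF assms(1-11), of "max 0 (min 1 x)"]
      by (simp add: emeasure_eq_measure)
  qed
  have D: "emeasure ?D {..<x} = ennreal (\<Gamma> (max 0 (min 1 x)) - \<Gamma> 0)" for x
  proof -
    let ?y = "max 0 (min 1 x)"
    have "emeasure ?D {..<x} = (\<integral>\<^sup>+ t. ennreal (\<Gamma>' t) * indicator {0..<1} t * indicator {..<x} t \<partial>lborel)"
      by (simp add: emeasure_density)
    also have "\<dots> = (\<integral>\<^sup>+ t. ennreal (\<Gamma>' t) * indicator {0..?y} t \<partial>lborel)"
      using AE_lborel_singleton[of 0] AE_lborel_singleton[of x] AE_lborel_singleton[of 1]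
      by (intro nn_integral_cong_AE, eventually_elim) (auto simp: indicator_def max_def min_def)
    also have "\<dots> = \<Gamma> ?y - \<Gamma> 0"
      by (rule nn_integral_FTC_Icc) (auto intro: \<Gamma>')
    finally show ?thesis .
  qed
  have gen: "sets borel = sigma_sets UNIV (range (lessThan :: real \<Rightarrow> real set))"
    by (simp add: borel_eq_lessThan eucl_lessThan) 
  show ?thesis
  proof (rule measure_eqI_generator_eq[where E = "range lessThan" and \<Omega> = UNIV and A = "\<lambda>n. {..<real n}"])
    show "Int_stable (range (lessThan :: real \<Rightarrow> real set))"
    proof (rule Int_stableI)
      fix A B :: "real set" assume "A \<in> range lessThan" "B \<in> range lessThan"
      then obtain a b where "A = {..<a}" "B = {..<b}" by blast
      then have "A \<inter> B = {..<min a b}" by auto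
      then show "A \<inter> B \<in> range lessThan" by blast
    qed
    show "sets N = sigma_sets UNIV (range lessThan)" "sets ?D = sigma_sets UNIV (range lessThan)"
      by (simp_all add: sets gen)
    show "(\<Union>n. {..<real n}) = UNIV" using reals_Archimedean2 by auto
  qed (auto simp: N D)
qed

text \<open>The image measure underlying \<open>unit_interval_measure\<close>, but on the Borel sets of the whole line, so
  that it can be compared with densities with respect to \<open>lborel\<close>.\<close>

definition pullback_measure :: "complex measure \<Rightarrow> real measure" where
  "pullback_measure \<mu> = distr \<mu> borel (the_inv_into {0..<1} circle_cov)"

text \<open>Invariance passes to the line because \<open>\<phi>\<close> corresponds on \<open>[0,1)\<close> to the lift reduced modulo 1.\<close>

lemma
  assumes \<mu>: "circle_invariant_prob \<phi> \<mu>" and F: "circle_lift \<phi> F"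
  shows prob_space_pullback_measure: "prob_space (pullback_measure \<mu>)"
    and AE_pullback_measure: "AE t in pullback_measure \<mu>. t \<in> {0..<1}"
    and pullback_measure_invariant:
      "distr (pullback_measure \<mu>) borel (\<lambda>t. frac (F t)) = pullback_measure \<mu>"
    and displacement_distribution_eq:
      "displacement_distribution F \<mu> = distr (pullback_measure \<mu>) borel (displacement F)"
proof -
  let ?i = "the_inv_into {0..<1} circle_cov"
  have sets_\<mu>: "sets \<mu> = sets (restrict_space borel (sphere 0 1))"
    and inv: "\<phi> \<in> measurable \<mu> \<mu>" "distr \<mu> \<mu> \<phi> = \<mu>"
    and "prob_space \<mu>"
    using \<mu> by (auto simp: circle_invariant_prob_def)
  interpret prob_space \<mu> by fact
  have space_\<mu>: "space \<mu> = sphere 0 1"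
    using sets_eq_imp_space_eq[OF sets_\<mu>] by (simp add: space_restrict_space)
  have i: "?i \<in> borel_measurable \<mu>"
    using measurable_the_inv_into_circle_cov by (simp add: measurable_cong_sets[OF sets_\<mu> refl])
  have [measurable]: "F \<in> borel_measurable borel"
    using F by (auto simp: circle_lift_def intro: borel_measurable_continuous_onI)
  show "prob_space (pullback_measure \<mu>)"
    unfolding pullback_measure_def using i by (rule prob_space_distr)
  show "AE t in pullback_measure \<mu>. t \<in> {0..<1}"
    unfolding pullback_measure_def
  proof (subst AE_distr_iff[OF i])
    show "AE z in \<mu>. ?i z \<in> {0..<1}"
      by (rule AE_I2) (simp only: space_\<mu> the_inv_into_circle_cov_in)
  qed auto
  have "distr (pullback_measure \<mu>) borel (\<lambda>t. frac (F t)) = distr \<mu> borel ((\<lambda>t. frac (F t)) \<circ> ?i)"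
    unfolding pullback_measure_def frac_def by (rule distr_distr[OF _ i]) measurable
  also have "\<dots> = distr \<mu> borel (?i \<circ> \<phi>)"
  proof (rule distr_cong[OF refl refl])
    fix z assume "z \<in> space \<mu>"
    then have z: "z = circle_cov (?i z)" by (simp add: space_\<mu> circle_cov_the_inv_into)
    have "\<phi> z = circle_cov (F (?i z))" using F by (subst z) (simp add: circle_lift_def)
    then show "((\<lambda>t. frac (F t)) \<circ> ?i) z = (?i \<circ> \<phi>) z" by (simp add: the_inv_into_circle_cov)
  qed
  also have "\<dots> = distr (distr \<mu> \<mu> \<phi>) borel ?i" by (rule distr_distr[symmetric, OF i inv(1)])
  finally show "distr (pullback_measure \<mu>) borel (\<lambda>t. frac (F t)) = pullback_measure \<mu>"
    by (simp add: inv(2) pullback_measure_def)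
  have i': "?i \<in> measurable \<mu> (restrict_space borel {0..<1})"
    using i by (rule measurable_restrict_space2[rotated])
      (use the_inv_into_circle_cov_in in \<open>simp add: space_\<mu> Pi_iff\<close>)
  have d: "displacement F \<in> borel_measurable borel"
    unfolding displacement_def[abs_def] by measurable
  have "displacement_distribution F \<mu> = distr \<mu> borel (displacement F \<circ> ?i)"
    unfolding displacement_distribution_def unit_interval_measure_def
    by (rule distr_distr[OF measurable_restrict_space1[OF d] i'])
  also have "\<dots> = distr (pullback_measure \<mu>) borel (displacement F)"
    unfolding pullback_measure_def by (rule distr_distr[symmetric, OF d i])
  finally show "displacement_distribution F \<mu> = distr (pullback_measure \<mu>) borel (displacement F)" .
qed

section \<open>The area formula on the real line\<close>

text \<open>Around a point where \<open>f'\<close> does not vanish there is a ball on which it keeps away from 0, and \<open>f\<close> is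
  injective there by the mean value theorem. By Lindelof's theorem countably many such open sets
  cover the noncritical points, and they can be made disjoint.\<close>

lemma countable_injectivity_partition:
  fixes f f' :: "real \<Rightarrow> real"
  assumes f: "\<And>x. (f has_real_derivative f' x) (at x)" and f': "continuous_on UNIV f'"
  shows "\<exists>S :: nat \<Rightarrow> real set. (\<forall>n. S n \<in> sets borel \<and> inj_on f (S n))
    \<and> disjoint_family S \<and> (\<Union>n. S n) = {x. f' x \<noteq> 0}"
proof -
  define \<F> where "\<F> = {U. open U \<and> inj_on f U \<and> U \<subseteq> {x. f' x \<noteq> 0}}"
  have cover: "\<exists>U\<in>\<F>. x \<in> U" if "f' x \<noteq> 0" for x
  proof -
    have "\<forall>\<^sub>F y in nhds x. dist (f' y) (f' x) < \<bar>f' x\<bar>"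
      using f' that unfolding continuous_on_eq_continuous_at[OF open_UNIV] isCont_def tendsto_iff
        eventually_nhds_conv_at by auto
    then obtain e where e: "e > 0" "\<And>y. dist y x < e \<Longrightarrow> dist (f' y) (f' x) < \<bar>f' x\<bar>"
      unfolding eventually_nhds_metric by blast
    have nz: "f' y \<noteq> 0" if "y \<in> ball x e" for y
      using e(2)[of y] that by (auto simp: dist_commute dist_real_def)
    have "inj_on f (ball x e)"
    proof (rule linorder_inj_onI)
      fix a b assume ab: "a < b" "a \<in> ball x e" "b \<in> ball x e"
      obtain z where z: "a < z" "z < b" "f b - f a = (b - a) * f' z"
        using MVT2[OF \<open>a < b\<close>, of f f'] f by blast
      have "z \<in> ball x e" using z ab by (auto simp: ball_eq_greaterThanLessThan)
      then show "f a \<noteq> f b" using z nz[of z] by auto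
    qed auto
    then have "ball x e \<in> \<F>" using nz by (auto simp: \<F>_def)
    then show ?thesis using e(1) by (intro bexI[of _ "ball x e"]) auto
  qed
  obtain \<G> where \<G>: "\<G> \<subseteq> \<F>" "countable \<G>" "\<Union>\<G> = \<Union>\<F>"
    using Lindelof[of \<F>] by (auto simp: \<F>_def)
  have "{} \<in> \<F>" by (simp add: \<F>_def)
  define A where "A = from_nat_into (insert {} \<G>)"
  have rangeA: "range A = insert {} \<G>"
    unfolding A_def using \<G>(2) by (intro range_from_nat_into) auto
  have A: "A n \<in> \<F>" for n
  proof -
    have "A n \<in> insert {} \<G>" unfolding rangeA[symmetric] by simp
    then show ?thesis using subsetD[OF \<G>(1)] \<open>{} \<in> \<F>\<close> by (elim insertE) simp_all
  qed
  have "(\<Union>n. A n) = \<Union>\<F>" using rangeA \<G>(3) by simp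
  also have "\<dots> = {x. f' x \<noteq> 0}"
  proof
    show "\<Union>\<F> \<subseteq> {x. f' x \<noteq> 0}" unfolding \<F>_def by blast
    show "{x. f' x \<noteq> 0} \<subseteq> \<Union>\<F>" using cover by blast
  qed
  finally have UA: "(\<Union>n. A n) = {x. f' x \<noteq> 0}" .
  show ?thesis
  proof (intro exI[of _ "disjointed A"] conjI allI)
    have "range A \<subseteq> sets borel" using A by (auto simp: \<F>_def)
    then show "disjointed A n \<in> sets borel" for n
      using sets.range_disjointed_sets[of A borel] by auto
    have "inj_on f (A n)" for n using A[of n] by (simp add: \<F>_def)
    then show "inj_on f (disjointed A n)" for n
      by (rule inj_on_subset) (rule disjointed_subset)
    show "disjoint_family (disjointed A)" by (rule disjoint_family_disjointed)
    show "(\<Union>n. disjointed A n) = {x. f' x \<noteq> 0}" using UA by (simp add: UN_disjointed_eq)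
  qed
qed

lemma nn_integral_fiber_inj:
  fixes f :: "'a \<Rightarrow> 'b" and q :: "'a \<Rightarrow> ennreal"
  assumes "inj_on f S" and x: "x \<in> S"
  shows "(\<integral>\<^sup>+ t. q t * indicator (S \<inter> f -` {f x}) t \<partial>count_space UNIV) = q x"
proof -
  have "S \<inter> f -` {f x} = {x}" using assms by (auto dest: inj_onD)
  then show ?thesis by (simp add: nn_integral_count_space_indicator[symmetric] nn_integral_count_space_finite)
qed

text \<open>The change of variables formula for an injective function. Its integrand on the image is written
  as a sum over the fiber, which has at most one point here, so that the formulas on several pieces
  can be added up without mentioning inverse functions.\<close>

lemma change_of_variables_inj_fiber:
  fixes f f' w :: "real \<Rightarrow> real"
  assumes S: "S \<in> sets borel" and f: "\<And>x. x \<in> S \<Longrightarrow> (f has_real_derivative f' x) (at x)"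
    and nz: "\<And>x. x \<in> S \<Longrightarrow> f' x \<noteq> 0" and inj: "inj_on f S"
    and w: "w absolutely_integrable_on S" "\<And>x. x \<in> S \<Longrightarrow> 0 \<le> w x"
  defines "h \<equiv> \<lambda>y. \<integral>\<^sup>+ x. ennreal (w x / \<bar>f' x\<bar>) * indicator (S \<inter> f -` {y}) x \<partial>count_space UNIV"
  shows "h \<in> borel_measurable lebesgue"
    and "(\<integral>\<^sup>+ y. h y \<partial>lebesgue) = (\<integral>\<^sup>+ x. ennreal (w x) * indicator S x \<partial>lebesgue)"
proof -
  define k where "k = (\<lambda>y. w (the_inv_into S f y) / \<bar>f' (the_inv_into S f y)\<bar>)"
  have k: "k (f x) = w x / \<bar>f' x\<bar>" if "x \<in> S" for x
    by (simp add: k_def the_inv_into_f_f[OF inj that])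
  have k_nonneg: "0 \<le> k y" if "y \<in> f ` S" for y using that w(2) by (auto simp: k)
  have h: "h y = ennreal (k y) * indicator (f ` S) y" for y
  proof (cases "y \<in> f ` S")
    case True
    then obtain x where "x \<in> S" "y = f x" by blast
    then show ?thesis using nn_integral_fiber_inj[OF inj] by (simp add: h_def k)
  next
    case False
    then have "S \<inter> f -` {y} = {}" by auto
    then show ?thesis using False by (simp add: h_def)
  qed
  have kw: "\<bar>f' x\<bar> * k (f x) = w x" if "x \<in> S" for x using nz[OF that] by (simp add: k that)
  have "(\<lambda>x. \<bar>f' x\<bar> * k (f x)) absolutely_integrable_on S"
    using w(1) kw by (subst set_integrable_cong[OF refl refl, of _ _ w]) auto
  moreover have "integral S (\<lambda>x. \<bar>f' x\<bar> * k (f x)) = integral S w"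
    by (rule Henstock_Kurzweil_Integration.integral_cong) (rule kw)
  ultimately have k_int: "k absolutely_integrable_on f ` S" "integral (f ` S) k = integral S w"
    using has_absolute_integral_change_of_variables_1'[of S f f' k] S f inj
    by (auto simp: has_field_derivative_at_within)
  then have "(\<lambda>y. indicator (f ` S) y *\<^sub>R k y) \<in> borel_measurable lebesgue"
    by (auto simp: set_integrable_def)
  then have "(\<lambda>y. ennreal (indicator (f ` S) y *\<^sub>R k y)) \<in> borel_measurable lebesgue" by simp
  also have "(\<lambda>y. ennreal (indicator (f ` S) y *\<^sub>R k y)) = h"
    by (auto simp: h fun_eq_iff indicator_def)
  finally show "h \<in> borel_measurable lebesgue" .
  have "(\<integral>\<^sup>+ y. h y \<partial>lebesgue) = ennreal (integral (f ` S) k)"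
    unfolding h nn_integral_completion
    by (intro nn_integral_has_integral_lebesgue' k_nonneg integrable_integral
        set_lebesgue_integral_eq_integral(1) k_int)
  also have "\<dots> = (\<integral>\<^sup>+ x. ennreal (w x) * indicator S x \<partial>lebesgue)"
    unfolding k_int(2) nn_integral_completion
    by (intro nn_integral_has_integral_lebesgue'[symmetric] w integrable_integral
        set_lebesgue_integral_eq_integral(1))
  finally show "(\<integral>\<^sup>+ y. h y \<partial>lebesgue) = (\<integral>\<^sup>+ x. ennreal (w x) * indicator S x \<partial>lebesgue)" .
qed

text \<open>The area formula for a weight \<open>w\<close>, with the density of the image written as a sum over the
  noncritical points of a fiber (an integral with respect to the counting measure). It follows by
  summing the injective case over the pieces of \<open>countable_injectivity_partition\<close>, since monotone
  convergence allows the sum to be exchanged with both integrals.\<close>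

lemma area_formula_real:
  fixes f f' w :: "real \<Rightarrow> real"
  assumes f: "\<And>x. (f has_real_derivative f' x) (at x)" and f': "continuous_on UNIV f'"
    and E: "E \<in> sets borel" and w: "w absolutely_integrable_on E" "\<And>x. x \<in> E \<Longrightarrow> 0 \<le> w x"
  defines "h \<equiv> \<lambda>y. \<integral>\<^sup>+ x. ennreal (w x / \<bar>f' x\<bar>)
    * indicator ({x \<in> E. f' x \<noteq> 0} \<inter> f -` {y}) x \<partial>count_space UNIV"
  shows "h \<in> borel_measurable lebesgue"
    and "A \<in> sets borel \<Longrightarrow> (\<integral>\<^sup>+ y\<in>A. h y \<partial>lebesgue)
      = (\<integral>\<^sup>+ x. ennreal (w x) * indicator ({x \<in> E. f' x \<noteq> 0} \<inter> f -` A) x \<partial>lebesgue)"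
proof -
  obtain S :: "nat \<Rightarrow> real set" where *: "(\<forall>n. S n \<in> sets borel \<and> inj_on f (S n))
      \<and> disjoint_family S \<and> (\<Union>n. S n) = {x. f' x \<noteq> 0}"
    using countable_injectivity_partition[OF f f'] ..
  then have S: "\<And>n. S n \<in> sets borel" "\<And>n. inj_on f (S n)" "disjoint_family S"
    and US: "(\<Union>n. S n) = {x. f' x \<noteq> 0}"
    by auto
  have [measurable]: "f \<in> borel_measurable borel"
    using f by (intro borel_measurable_continuous_onI DERIV_continuous_on) (auto simp: has_field_derivative_at_within)
  \<comment> \<open>The set \<open>A\<close> of values enters through the pieces rather than through the integrand, so the
    injective case applies with \<open>w\<close> itself as the weight.\<close>
  define P where "P A n = E \<inter> f -` A \<inter> S n" for A n
  define g where "g A n y =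
    (\<integral>\<^sup>+ x. ennreal (w x / \<bar>f' x\<bar>) * indicator (P A n \<inter> f -` {y}) x
      \<partial>count_space UNIV)" for A n y
  have sum_ind: "(\<Sum>n. indicator (S n) x) = (indicator {x. f' x \<noteq> 0} x :: ennreal)" for x
    using suminf_indicator[OF S(3)] US by simp
  have P_borel: "P A n \<in> sets borel" if "A \<in> sets borel" for A n
    using E S(1) measurable_sets_borel[of f borel A] that unfolding P_def by auto
  have P: "g A n \<in> borel_measurable lebesgue"
    "(\<integral>\<^sup>+ y. g A n y \<partial>lebesgue) = (\<integral>\<^sup>+ x. ennreal (w x) * indicator (P A n) x \<partial>lebesgue)"
    if "A \<in> sets borel" for A n
  proof -
    have "w absolutely_integrable_on P A n"
      by (rule set_integrable_subset[OF w(1)]) (use P_borel[OF that] in \<open>auto simp: P_def\<close>)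
    moreover have "f' x \<noteq> 0" if "x \<in> P A n" for x using that US by (auto simp: P_def)
    moreover have "inj_on f (P A n)" using S(2) by (rule inj_on_subset) (auto simp: P_def)
    ultimately show "g A n \<in> borel_measurable lebesgue"
      "(\<integral>\<^sup>+ y. g A n y \<partial>lebesgue) = (\<integral>\<^sup>+ x. ennreal (w x) * indicator (P A n) x \<partial>lebesgue)"
      unfolding g_def using f w(2)
      by (intro change_of_variables_inj_fiber P_borel that; auto simp: P_def)+
  qed
  have h_sum: "h y * indicator A y = (\<Sum>n. g A n y)" for A y
  proof -
    have "(\<Sum>n. g A n y) = (\<integral>\<^sup>+ x. (\<Sum>n. ennreal (w x / \<bar>f' x\<bar>)
        * indicator (P A n \<inter> f -` {y}) x) \<partial>count_space UNIV)"
      unfolding g_def by (subst nn_integral_suminf) auto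
    also have "\<dots> = (\<integral>\<^sup>+ x. ennreal (w x / \<bar>f' x\<bar>)
        * indicator ({x \<in> E. f' x \<noteq> 0} \<inter> f -` {y}) x * indicator A y \<partial>count_space UNIV)"
    proof (intro nn_integral_cong)
      fix x
      have "(\<Sum>n. ennreal (w x / \<bar>f' x\<bar>) * indicator (P A n \<inter> f -` {y}) x)
          = (\<Sum>n. (ennreal (w x / \<bar>f' x\<bar>) * indicator (E \<inter> f -` A \<inter> f -` {y}) x) * indicator (S n) x)"
        by (intro suminf_cong) (auto simp: P_def indicator_def)
      also have "\<dots> = (ennreal (w x / \<bar>f' x\<bar>) * indicator (E \<inter> f -` A \<inter> f -` {y}) x)
          * indicator {x. f' x \<noteq> 0} x"
        by (simp add: sum_ind)
      finally show "(\<Sum>n. ennreal (w x / \<bar>f' x\<bar>) * indicator (P A n \<inter> f -` {y}) x)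
          = ennreal (w x / \<bar>f' x\<bar>) * indicator ({x \<in> E. f' x \<noteq> 0} \<inter> f -` {y}) x * indicator A y"
        by (auto simp: indicator_def)
    qed
    also have "\<dots> = h y * indicator A y" by (simp add: h_def nn_integral_multc)
    finally show ?thesis by simp
  qed
  have "h = (\<lambda>y. \<Sum>n. g UNIV n y)" using h_sum[of _ UNIV] by (simp add: fun_eq_iff)
  then show "h \<in> borel_measurable lebesgue" using P(1)[of UNIV] by simp
  assume A: "A \<in> sets borel"
  have "(\<integral>\<^sup>+ y\<in>A. h y \<partial>lebesgue) = (\<Sum>n. \<integral>\<^sup>+ y. g A n y \<partial>lebesgue)"
    unfolding h_sum using P(1)[OF A] by (rule nn_integral_suminf)
  also have "\<dots> = (\<Sum>n. \<integral>\<^sup>+ x. ennreal (w x) * indicator E x * indicator (f -` A) x * indicator (S n) x \<partial>lebesgue)"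
    unfolding P(2)[OF A] by (intro suminf_cong nn_integral_cong) (auto simp: P_def indicator_def)
  also have "\<dots> = (\<integral>\<^sup>+ x. (\<Sum>n. ennreal (w x) * indicator E x * indicator (f -` A) x * indicator (S n) x) \<partial>lebesgue)"
  proof (rule nn_integral_suminf[symmetric])
    have "(\<lambda>x. indicator E x *\<^sub>R w x) \<in> borel_measurable lebesgue"
      using w(1) by (auto simp: set_integrable_def)
    then have "(\<lambda>x. ennreal (indicator E x *\<^sub>R w x)) \<in> borel_measurable lebesgue" by simp
    also have "(\<lambda>x. ennreal (indicator E x *\<^sub>R w x)) = (\<lambda>x. ennreal (w x) * indicator E x)"
      by (auto simp: fun_eq_iff indicator_def)
    finally have wE: "(\<lambda>x. ennreal (w x) * indicator E x) \<in> borel_measurable lebesgue" .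
    show "(\<lambda>x. ennreal (w x) * indicator E x * indicator (f -` A) x * indicator (S n) x) \<in> borel_measurable lebesgue" for n
      using measurable_sets_borel[of f borel A] A S(1)
      by (intro borel_measurable_times_ennreal[OF borel_measurable_times_ennreal[OF wE]]
          borel_measurable_indicator) auto
  qed
  also have "\<dots> = (\<integral>\<^sup>+ x. ennreal (w x) * indicator ({x \<in> E. f' x \<noteq> 0} \<inter> f -` A) x \<partial>lebesgue)"
    unfolding ennreal_suminf_cmult sum_ind by (intro nn_integral_cong) (auto simp: indicator_def)
  finally show "(\<integral>\<^sup>+ y\<in>A. h y \<partial>lebesgue)
    = (\<integral>\<^sup>+ x. ennreal (w x) * indicator ({x \<in> E. f' x \<noteq> 0} \<inter> f -` A) x \<partial>lebesgue)" .
qed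

lemma distr_density_fiber_sum:
  fixes f f' w :: "real \<Rightarrow> real"
  assumes f: "\<And>x. (f has_real_derivative f' x) (at x)" and f': "continuous_on UNIV f'"
    and E: "E \<in> sets borel" and crit: "{x \<in> E. f' x = 0} \<in> null_sets lborel"
    and w: "w \<in> borel_measurable borel" "w absolutely_integrable_on E" "\<And>x. x \<in> E \<Longrightarrow> 0 \<le> w x"
    and A: "A \<in> sets borel"
  shows "emeasure (distr (density lborel (\<lambda>x. ennreal (w x) * indicator E x)) borel f) A
    = (\<integral>\<^sup>+ y\<in>A. (\<integral>\<^sup>+ x. ennreal (w x / \<bar>f' x\<bar>)
        * indicator ({x \<in> E. f' x \<noteq> 0} \<inter> f -` {y}) x \<partial>count_space UNIV) \<partial>lebesgue)"
proof -
  have [measurable]: "f \<in> borel_measurable borel"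
    using f by (intro borel_measurable_continuous_onI DERIV_continuous_on) (auto simp: has_field_derivative_at_within)
  have fA: "f -` A \<in> sets borel" using measurable_sets_borel[of f borel A] A by simp
  note [measurable] = w(1) E A
  have "emeasure (distr (density lborel (\<lambda>x. ennreal (w x) * indicator E x)) borel f) A
      = (\<integral>\<^sup>+ x. ennreal (w x) * indicator E x * indicator (f -` A) x \<partial>lborel)"
    using fA by (simp add: emeasure_distr emeasure_density)
  also have "\<dots> = (\<integral>\<^sup>+ x. ennreal (w x) * indicator ({x \<in> E. f' x \<noteq> 0} \<inter> f -` A) x \<partial>lborel)"
    using AE_not_in[OF crit] by (intro nn_integral_cong_AE, eventually_elim) (auto simp: indicator_def)
  finally show ?thesis
    using area_formula_real(2)[OF f f' E w(2,3) A] by (simp add: nn_integral_completion)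
qed

section \<open>Critical values and the support of a measure\<close>

text \<open>An infinite fiber accumulates in the compact set at one of its own points, and the difference
  quotients of \<open>f\<close> along the fiber vanish there, so that point is critical.\<close>

lemma finite_regular_fiber:
  fixes f f' :: "real \<Rightarrow> real"
  assumes K: "compact K" and f: "\<And>x. x \<in> K \<Longrightarrow> (f has_real_derivative f' x) (at x)"
    and nz: "\<And>x. x \<in> K \<Longrightarrow> f x = y \<Longrightarrow> f' x \<noteq> 0"
  shows "finite (f -` {y} \<inter> K)"
proof (rule ccontr)
  assume inf: "infinite (f -` {y} \<inter> K)"
  have "continuous_on K f"
    using f by (intro DERIV_continuous_on) (auto intro: has_field_derivative_at_within)
  then have "closed (f -` {y} \<inter> K)"
    using continuous_on_closed_vimage[OF compact_imp_closed[OF K]] closed_singleton by blast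
  then have "compact (f -` {y} \<inter> K)"
    using K by (metis closed_Int_compact inf.idem inf_assoc)
  then obtain x where x: "x \<in> f -` {y} \<inter> K" "x islimpt (f -` {y} \<inter> K)"
    using Heine_Borel_imp_Bolzano_Weierstrass[OF _ inf order_refl] by blast
  have "((\<lambda>z. (f z - f x) / (z - x)) \<longlongrightarrow> f' x) (at x)"
    using f[of x] x(1) unfolding has_field_derivative_iff by blast
  then have "\<forall>\<^sub>F z in at x. (f z - f x) / (z - x) \<noteq> 0"
    by (rule tendsto_imp_eventually_ne) (use nz x(1) in auto)
  then have "\<forall>\<^sub>F z in at x. z \<notin> f -` {y} \<inter> K"
    by eventually_elim (use x(1) in auto)
  then show False using x(2) by (simp add: islimpt_iff_eventually)
qed

lemma measure_support_compl: "- measure_support M = \<Union>{U. open U \<and> emeasure M U = 0}"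
  by (auto simp: measure_support_def zero_less_iff_neq_zero)

lemma closed_measure_support: "closed (measure_support M)"
  unfolding closed_def measure_support_compl by auto

text \<open>The complement of the support is the union of all open null sets, and countably many of these
  already cover it.\<close>

lemma compl_measure_support_null:
  fixes M :: "'a::second_countable_topology measure"
  assumes "sets M = sets borel"
  shows "- measure_support M \<in> null_sets M"
proof -
  obtain \<G> where \<G>: "\<G> \<subseteq> {U. open U \<and> emeasure M U = 0}" "countable \<G>"
      "\<Union>\<G> = \<Union>{U. open U \<and> emeasure M U = 0}"
    using Lindelof[of "{U. open U \<and> emeasure M U = 0}"] by blast
  have "U \<in> null_sets M" if "U \<in> \<G>" for U
    using that \<G>(1) assms by (auto simp: null_sets_def)
  then have "\<Union>\<G> \<in> null_sets M"
    using null_sets_UN'[OF \<G>(2), of "\<lambda>U. U" M] by simp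
  then show ?thesis using \<G>(3) by (simp add: measure_support_compl)
qed

lemma borel_measurable_lebesgue_AE_cong:
  fixes g h :: "'a::euclidean_space \<Rightarrow> 'b::topological_space"
  assumes g: "g \<in> borel_measurable lebesgue" and "AE x in lebesgue. g x = h x"
  shows "h \<in> borel_measurable lebesgue"
proof (rule measurableI)
  fix A :: "'b set" assume "A \<in> sets borel"
  have gA: "g -` A \<inter> space lebesgue \<in> sets lebesgue" using g \<open>A \<in> sets borel\<close> by (rule measurable_sets)
  have eq: "AE x in lebesgue. x \<in> g -` A \<inter> space lebesgue \<longleftrightarrow> x \<in> h -` A \<inter> space lebesgue"
    using assms(2) by eventually_elim auto
  show "h -` A \<inter> space lebesgue \<in> sets lebesgue"
    by (rule complete_measure.in_sets_AE[OF completion.complete_measure_axioms eq gA]) simp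
qed auto

section \<open>The density of the displacement distribution\<close>

theorem theorem3p10:
  fixes \<phi> \<gamma> :: "complex \<Rightarrow> complex" and \<Phi> \<Gamma> :: "real \<Rightarrow> real" and \<mu> :: "complex measure"
  assumes "circle_C1_diffeo \<phi>" and "circle_orientation_preserving \<phi>" and "circle_transitive \<phi>"
    and "circle_lift \<phi> \<Phi>" and "\<Phi> 0 \<in> {0<..<1}"
    and "rotation_number \<Phi> \<notin> \<rat>"
    and "circle_C1_diffeo \<gamma>" and "circle_lift \<gamma> \<Gamma>" and "\<forall>x. \<Gamma> (x + 1) = \<Gamma> x + 1"
    and "\<forall>x. \<Gamma> (\<Phi> x) = \<Gamma> x + rotation_number \<Phi>"
    and "circle_invariant_prob \<phi> \<mu>"
    and "critical_points (displacement \<Phi>) \<in> null_sets lborel"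
  shows "is_lebesgue_density (displacement_distribution \<Phi> \<mu>) (displacement_density \<Phi> \<Gamma> \<mu>)
    \<and> measure_support (displacement_distribution \<Phi> \<mu>)
        \<inter> displacement \<Phi> ` critical_points (displacement \<Phi>) \<in> null_sets lborel
    \<and> (\<forall>y \<in> measure_support (displacement_distribution \<Phi> \<mu>)
            - displacement \<Phi> ` critical_points (displacement \<Phi>).
         finite (displacement \<Phi> -` {y} \<inter> {0..<1})
         \<and> (\<forall>x \<in> displacement \<Phi> -` {y} \<inter> {0..<1}. deriv \<Phi> x - 1 \<noteq> 0))"
proof -
  define \<rho> where "\<rho> = rotation_number \<Phi>"
  define \<Psi> where "\<Psi> = displacement \<Phi>"
  define C where "C = critical_points \<Psi>"
  define M where "M = displacement_distribution \<Phi> \<mu>"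
  have \<Gamma>_per: "\<Gamma> (x + 1) = \<Gamma> x + 1" and conj: "\<Gamma> (\<Phi> x) = \<Gamma> x + \<rho>" for x
    using assms by (auto simp: \<rho>_def)
  have "inj_on \<gamma> (sphere 0 1)" using assms(7) by (simp add: circle_C1_diffeo_def bij_betw_def)
  then have \<Gamma>_mono: "strict_mono \<Gamma>" using circle_lift_strict_mono assms(8) \<Gamma>_per by blast
  have \<Gamma>_surj: "surj \<Gamma>"
    using assms(8) by (intro degree_one_surj \<Gamma>_per) (simp add: circle_lift_def)
  have \<Phi>_per: "\<Phi> (x + 1) = \<Phi> x + 1" for x
  proof -
    have "\<Gamma> (\<Phi> (x + 1)) = \<Gamma> (\<Phi> x + 1)" by (simp add: conj \<Gamma>_per)
    then show ?thesis using strict_mono_eq[OF \<Gamma>_mono] by blast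
  qed
  have \<Phi>_mono: "strict_mono \<Phi>"
  proof (rule strict_monoI)
    fix x y :: real assume "x < y"
    then have "\<Gamma> (\<Phi> x) < \<Gamma> (\<Phi> y)" by (simp add: conj strict_mono_less[OF \<Gamma>_mono])
    then show "\<Phi> x < \<Phi> y" by (simp only: strict_mono_less[OF \<Gamma>_mono])
  qed
  have "circle_C1_map \<gamma>" "circle_C1_map \<phi>"
    using assms(1,7) by (simp_all add: circle_C1_diffeo_def)
  then obtain \<Gamma>' \<Phi>' where
    \<Gamma>': "\<And>x. (\<Gamma> has_real_derivative \<Gamma>' x) (at x)" "continuous_on UNIV \<Gamma>'" and
    \<Phi>': "\<And>x. (\<Phi> has_real_derivative \<Phi>' x) (at x)" "continuous_on UNIV \<Phi>'"
    using circle_lift_C1[OF _ assms(8)] circle_lift_C1[OF _ assms(4)] by metis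
  have \<Gamma>'_nonneg: "0 \<le> \<Gamma>' x" for x
    using mono_on_imp_deriv_nonneg[of UNIV \<Gamma> "\<Gamma>' x" x] \<Gamma>'(1) strict_mono_mono[OF \<Gamma>_mono] by simp
  have \<Psi>: "(\<Psi> has_real_derivative \<Phi>' x - 1) (at x)" for x
    unfolding \<Psi>_def displacement_def[abs_def] using \<Phi>'(1) by (auto intro!: derivative_eq_intros)
  have \<Psi>'_cont: "continuous_on UNIV (\<lambda>x. \<Phi>' x - 1)" using \<Phi>'(2) by (intro continuous_intros)
  have \<Psi>_cont: "continuous_on A \<Psi>" for A
    using \<Psi> by (intro DERIV_continuous_on) (auto intro: has_field_derivative_at_within)
  have derivs: "deriv \<Gamma> = \<Gamma>'" "deriv \<Phi> = \<Phi>'" "deriv \<Psi> = (\<lambda>x. \<Phi>' x - 1)"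
    using \<Gamma>'(1) \<Phi>'(1) \<Psi> by (auto simp: fun_eq_iff intro!: DERIV_imp_deriv)
  have C_eq: "C = {0..1} \<inter> {x. \<Phi>' x - 1 = 0}"
    by (auto simp: C_def critical_points_def derivs)
  have "closed {x. \<Phi>' x - 1 = 0}" by (intro closed_Collect_eq \<Psi>'_cont) auto
  then have C_compact: "compact C" unfolding C_eq by (intro compact_Int_closed) auto
  have C_null: "C \<in> null_sets lborel" using assms(12) by (simp add: C_def \<Psi>_def)
  \<comment> \<open>A differentiable function maps null sets to null sets; compactness makes the image a Borel set.\<close>
  have V_null: "\<Psi> ` C \<in> null_sets lborel"
  proof -
    have "negligible C"
      unfolding negligible_iff_null_sets using C_null by (rule null_sets_completionI)
    moreover have "\<Psi> differentiable_on C"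
      unfolding differentiable_on_def
      by (intro ballI differentiableI[OF has_field_derivative_imp_has_derivative[OF
            has_field_derivative_at_within[OF \<Psi>]]])
    ultimately have "negligible (\<Psi> ` C)"
      by (rule negligible_differentiable_image_negligible[OF order_refl])
    moreover have "closed (\<Psi> ` C)"
      using C_compact \<Psi>_cont by (intro compact_imp_closed compact_continuous_image)
    ultimately show ?thesis
      by (simp add: negligible_iff_null_sets null_sets_completion_iff)
  qed
  have fiber: "finite (\<Psi> -` {y} \<inter> {0..<1})" "\<And>x. x \<in> \<Psi> -` {y} \<inter> {0..<1} \<Longrightarrow> \<Phi>' x - 1 \<noteq> 0"
    if "y \<notin> \<Psi> ` C" for y
  proof -
    have nz: "\<Phi>' x - 1 \<noteq> 0" if "x \<in> {0..1}" "\<Psi> x = y" for x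
      using \<open>y \<notin> \<Psi> ` C\<close> that by (auto simp: C_eq)
    then have "finite (\<Psi> -` {y} \<inter> {0..1})"
      by (intro finite_regular_fiber[OF compact_Icc \<Psi>])
    then show "finite (\<Psi> -` {y} \<inter> {0..<1})" by (rule rev_finite_subset) auto
    show "\<Phi>' x - 1 \<noteq> 0" if "x \<in> \<Psi> -` {y} \<inter> {0..<1}" for x using nz that by auto
  qed
  define h where "h y = (\<integral>\<^sup>+ x. ennreal (\<Gamma>' x / \<bar>\<Phi>' x - 1\<bar>)
      * indicator ({x \<in> {0..<1}. \<Phi>' x - 1 \<noteq> 0} \<inter> \<Psi> -` {y}) x \<partial>count_space UNIV)" for y
  have \<Gamma>'_int: "\<Gamma>' absolutely_integrable_on {0..<1}"
    by (rule set_integrable_subset[OF absolutely_integrable_continuous_real[of 0 1]])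
      (auto intro: continuous_on_subset[OF \<Gamma>'(2)])
  have h_meas: "h \<in> borel_measurable lebesgue"
    unfolding h_def by (rule area_formula_real(1)[OF \<Psi> \<Psi>'_cont _ \<Gamma>'_int]) (auto intro: \<Gamma>'_nonneg)
  have pull: "pullback_measure \<mu> = density lborel (\<lambda>x. ennreal (\<Gamma>' x) * indicator {0..<1} x)"
    by (rule invariant_measure_eq_density[OF prob_space_pullback_measure[OF assms(11,4)] _
          AE_pullback_measure[OF assms(11,4)] pullback_measure_invariant[OF assms(11,4)]
          \<Phi>_mono \<Phi>_per \<Gamma>_mono \<Gamma>_surj \<Gamma>_per conj _ \<Gamma>' \<Gamma>'_nonneg])
      (use assms(6) in \<open>auto simp: pullback_measure_def \<rho>_def\<close>)
  have M_eq: "emeasure M A = (\<integral>\<^sup>+ y\<in>A. h y \<partial>lebesgue)" if "A \<in> sets borel" for A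
    unfolding M_def displacement_distribution_eq[OF assms(11,4)] pull h_def \<Psi>_def[symmetric]
  proof (rule distr_density_fiber_sum[OF \<Psi> \<Psi>'_cont _ _ _ \<Gamma>'_int _ that])
    have "{x \<in> {0..<1}. \<Phi>' x - 1 = 0} = C \<inter> {0..<1}" by (auto simp: C_eq)
    then show "{x \<in> {0..<1}. \<Phi>' x - 1 = 0} \<in> null_sets lborel"
      using C_null by (simp add: null_set_Int2)
    show "\<Gamma>' \<in> borel_measurable borel" using \<Gamma>'(2) by (rule borel_measurable_continuous_onI)
  qed (auto intro: \<Gamma>'_nonneg)
  define \<Delta> where "\<Delta> = displacement_density \<Phi> \<Gamma> \<mu>"
  have \<Delta>: "\<Delta> y = (if y \<notin> measure_support M then 0
      else \<Sum>x\<in>\<Psi> -` {y} \<inter> {0..<1}. \<Gamma>' x / \<bar>\<Phi>' x - 1\<bar>)" for y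
    by (simp add: \<Delta>_def displacement_density_def M_def \<Psi>_def derivs)
  have \<Delta>_nonneg: "0 \<le> \<Delta> y" for y by (auto simp: \<Delta> intro!: sum_nonneg divide_nonneg_nonneg \<Gamma>'_nonneg)
  have h_sum: "h y = ennreal (\<Sum>x\<in>\<Psi> -` {y} \<inter> {0..<1}. \<Gamma>' x / \<bar>\<Phi>' x - 1\<bar>)" if "y \<notin> \<Psi> ` C" for y
  proof -
    have "{x \<in> {0..<1}. \<Phi>' x - 1 \<noteq> 0} \<inter> \<Psi> -` {y} = \<Psi> -` {y} \<inter> {0..<1}"
      using fiber(2)[OF that] by auto
    then show ?thesis
      using fiber(1)[OF that]
      by (simp add: h_def nn_integral_count_space_indicator[symmetric]
          nn_integral_count_space_finite sum_ennreal \<Gamma>'_nonneg)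
  qed
  have sets_M: "sets M = sets borel" by (simp add: M_def displacement_distribution_def)
  have supp_borel: "- measure_support M \<in> sets borel" using closed_measure_support[of M] by auto
  \<comment> \<open>The density \<open>h\<close> from the area formula vanishes almost everywhere off the support because \<open>M\<close> has no
    mass there; \<open>\<Delta>\<close> is 0 there by definition.\<close>
  have "(\<integral>\<^sup>+ y\<in>- measure_support M. h y \<partial>lebesgue) = 0"
    using M_eq[OF supp_borel] compl_measure_support_null[OF sets_M] by (simp add: null_setsD1)
  then have "AE y in lebesgue. h y * indicator (- measure_support M) y = 0"
    using supp_borel
    by (subst (asm) nn_integral_0_iff_AE)
      (auto intro!: borel_measurable_times_ennreal h_meas borel_measurable_indicator)
  moreover have "AE y in lebesgue. y \<notin> \<Psi> ` C"
    using V_null by (intro AE_not_in null_sets_completionI)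
  ultimately have h_\<Delta>: "AE y in lebesgue. h y = ennreal (\<Delta> y)"
    by eventually_elim (auto simp: \<Delta> h_sum indicator_def split: if_splits)
  have "(\<lambda>y. enn2real (h y)) \<in> borel_measurable lebesgue" using h_meas by simp
  then have \<Delta>_meas: "\<Delta> \<in> borel_measurable lebesgue"
    using h_\<Delta> by (rule borel_measurable_lebesgue_AE_cong[OF _ eventually_mono]) (simp add: \<Delta>_nonneg)
  have "emeasure M A = (\<integral>\<^sup>+ y\<in>A. ennreal (\<Delta> y) \<partial>lebesgue)" if "A \<in> sets borel" for A
    unfolding M_eq[OF that] using h_\<Delta> by (intro nn_integral_cong_AE, eventually_elim) simp
  then have "is_lebesgue_density M \<Delta>"
    using \<Delta>_meas \<Delta>_nonneg by (simp add: is_lebesgue_density_def)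
  moreover have "measure_support M \<inter> \<Psi> ` C \<in> null_sets lborel"
    using V_null closed_measure_support[of M] by (intro null_set_Int1) auto
  moreover have "\<forall>y \<in> measure_support M - \<Psi> ` C. finite (\<Psi> -` {y} \<inter> {0..<1})
      \<and> (\<forall>x \<in> \<Psi> -` {y} \<inter> {0..<1}. deriv \<Phi> x - 1 \<noteq> 0)"
    using fiber unfolding derivs by blast
  ultimately show ?thesis unfolding M_def \<Delta>_def C_def \<Psi>_def by blast
qed

end
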